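(* Consider the majority-minimization algorithm for $\min_{\hat X\in\mathcal X^m}F(C(\hat X))$ described in the context. When the minimizer of $\min_{\hat X\in\mathcal X^m}g(\hat X;\hat X^k)$ is unique (at each iteration $k$), the algorithm terminates within finitely many iterations.
   Context: Setting: $\mathcal Z=\mathcal D\times\mathcal X\times\mathcal Y\subseteq\mathbb R^d$ with $\mathcal D,\mathcal Y$ finite. Data $Z_i=(D_i,X_i,Y_i)\in\mathcal Z$, $i\in[n]$. Coreset points $\hat Z_j=(\hat D_j,\hat X_j,\hat Y_j)$, $j\in[m]$, with $\hat D_j,\hat Y_j$ fixed and $\hat X=(\hat X_1,\dots,\hat X_m)\in\mathcal X^m$ variable. The cost matrix $C(\hat X)\in\mathbb R^{n\times m}$ has entries $C(\hat X)_{ij}=c(Z_i,\hat Z_j)$ for a transportation cost $c$, and $C(\hat X)$ is a convex function of $\hat X$ (as is the case, e.g., when any $L^p$ norm defines the cost). Let $\epsilon$ be the maximum allowed fairness violation, let $p_{Y_T}$ be a target probability distribution on $\mathcal Y$, and let $A$ be the matrix with $2|\mathcal Y||\mathcal D|$ rows and $m$ columns such that, for $\theta\in\mathbb R^m$, $A\theta\ge\mathbf0$ encodes, for all $d\in\mathcal D$, $y\in\mathcal Y$, $$(1-\epsilon)\,p_{Y_T}(y)\sum_{i:\hat D_i=d}\theta_i\ \le\ \sum_{i:\hat D_i=d,\hat Y_i=y}\theta_i\ \le\ (1+\epsilon)\,p_{Y_T}(y)\sum_{i:\hat D_i=d}\theta_i .$$ For $C\in\mathbb R^{n\times m}$, $F(C)$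 denotes the optimal objective value of the linear program $$\min_{P\in\mathbb R^{n\times m}}\ \langle C,P\rangle\quad\text{s.t.}\quad P\mathbf1_m=\tfrac1n\mathbf1_n,\ P\ge\mathbf0,\ AP^\top\mathbf1_n\ge\mathbf0,$$ where $\langle\cdot,\cdot\rangle$ is the Frobenius inner product and $\mathbf1_r$ is the all-ones vector in $\mathbb R^r$. Algorithm: start from $\hat X^0\in\mathcal X^m$. At iteration $k$, let $P_k^\star$ be an optimal solution of the linear program defining $F(C(\hat X^k))$, put $g(\hat X;\hat X^k)=\langle C(\hat X),P_k^\star\rangle$, and let $\hat X^{k+1}\in\arg\min_{\hat X\in\mathcal X^m}g(\hat X;\hat X^k)$. The algorithm terminates at iteration $k$ if $g(\hat X^{k+1};\hat X^k)=g(\hat X^k;\hat X^k)$; otherwise it continues with $k+1$. *)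

theory Defs
  imports "HOL-Analysis.Analysis" "HOL-Probability.Probability_Mass_Function"
begin

definition cost_matrix ::
  "('z \<Rightarrow> 'd \<times> 'x \<times> 'y \<Rightarrow> real) \<Rightarrow> ('n \<Rightarrow> 'z) \<Rightarrow> ('m \<Rightarrow> 'd) \<Rightarrow> ('m \<Rightarrow> 'y) \<Rightarrow> 'x ^ 'm \<Rightarrow> real ^ 'm ^ 'n"
  where "cost_matrix c Z Dh Yh X = (\<chi> i j. c (Z i) (Dh j, X $ j, Yh j))"

definition tuples :: "'x set \<Rightarrow> ('x ^ 'm) set"
  where "tuples S = {X. \<forall>j. X $ j \<in> S}"

text \<open>The order on vectors is the componentwise one. No order or scaling of the rows of \<open>A\<close> is fixed.\<close>

definition fairness_matrix ::
  "real \<Rightarrow> 'y pmf \<Rightarrow> 'd set \<Rightarrow> 'y set \<Rightarrow> ('m \<Rightarrow> 'd) \<Rightarrow> ('m \<Rightarrow> 'y) \<Rightarrow> real ^ 'm ^ 'r \<Rightarrow> bool"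
  where "fairness_matrix \<epsilon> p D Y Dh Yh A \<longleftrightarrow>
    CARD('r) = 2 * card Y * card D \<and>
    (\<forall>\<theta>. 0 \<le> A *v \<theta> \<longleftrightarrow>
      (\<forall>d\<in>D. \<forall>y\<in>Y.
        (1 - \<epsilon>) * pmf p y * (\<Sum>i | Dh i = d. \<theta> $ i) \<le> (\<Sum>i | Dh i = d \<and> Yh i = y. \<theta> $ i) \<and>
        (\<Sum>i | Dh i = d \<and> Yh i = y. \<theta> $ i) \<le> (1 + \<epsilon>) * pmf p y * (\<Sum>i | Dh i = d. \<theta> $ i)))"

text \<open>In the linear program, \<open>1\<close> is the all-ones vector, and the inner product on
  \<^typ>\<open>real ^ 'm ^ 'n\<close> is the Frobenius inner product.\<close>

definition lp_feasible :: "real ^ 'm ^ 'r \<Rightarrow> (real ^ 'm ^ 'n) set"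
  where "lp_feasible A =
    {P. P *v 1 = (1 / real CARD('n)) *\<^sub>R 1 \<and> 0 \<le> P \<and> 0 \<le> A *v (transpose P *v 1)}"

text \<open>The feasible set is bounded, so this infimum is the optimal value whenever the program is
  feasible; it is unspecified otherwise.\<close>

definition lp_value :: "real ^ 'm ^ 'r \<Rightarrow> real ^ 'm ^ 'n \<Rightarrow> real"
  where "lp_value A C = (INF P \<in> lp_feasible A. C \<bullet> P)"

definition lp_optimal :: "real ^ 'm ^ 'r \<Rightarrow> real ^ 'm ^ 'n \<Rightarrow> real ^ 'm ^ 'n \<Rightarrow> bool"
  where "lp_optimal A C P \<longleftrightarrow> P \<in> lp_feasible A \<and> C \<bullet> P = lp_value A C"

text \<open>The surrogate \<open>g(X; X\<^sup>k)\<close> depends on \<open>X\<^sup>k\<close> only through the chosen optimal solution \<open>P\<close>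
  of the linear program at \<open>X\<^sup>k\<close>.\<close>

definition surrogate :: "('x ^ 'm \<Rightarrow> real ^ 'm ^ 'n) \<Rightarrow> real ^ 'm ^ 'n \<Rightarrow> 'x ^ 'm \<Rightarrow> real"
  where "surrogate C P X = C X \<bullet> P"

definition terminates_at ::
  "('x ^ 'm \<Rightarrow> real ^ 'm ^ 'n) \<Rightarrow> (nat \<Rightarrow> 'x ^ 'm) \<Rightarrow> (nat \<Rightarrow> real ^ 'm ^ 'n) \<Rightarrow> nat \<Rightarrow> bool"
  where "terminates_at C X P k \<longleftrightarrow> surrogate C (P k) (X (Suc k)) = surrogate C (P k) (X k)"

text \<open>Iteration \<open>k\<close> is executed if the algorithm did not terminate at an earlier one. The values of
  the sequences past the first terminating iteration are irrelevant and left unconstrained.\<close>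

definition executes ::
  "('x ^ 'm \<Rightarrow> real ^ 'm ^ 'n) \<Rightarrow> (nat \<Rightarrow> 'x ^ 'm) \<Rightarrow> (nat \<Rightarrow> real ^ 'm ^ 'n) \<Rightarrow> nat \<Rightarrow> bool"
  where "executes C X P k \<longleftrightarrow> (\<forall>j<k. \<not> terminates_at C X P j)"

definition mm_run ::
  "'x set \<Rightarrow> real ^ 'm ^ 'r \<Rightarrow> ('x ^ 'm \<Rightarrow> real ^ 'm ^ 'n) \<Rightarrow> (nat \<Rightarrow> 'x ^ 'm)
    \<Rightarrow> (nat \<Rightarrow> real ^ 'm ^ 'n) \<Rightarrow> bool"
  where "mm_run S A C X P \<longleftrightarrow>
    X 0 \<in> tuples S \<and>
    (\<forall>k. executes C X P k \<longrightarrow>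
      lp_optimal A (C (X k)) (P k) \<and>
      is_arg_min (surrogate C (P k)) (\<lambda>X'. X' \<in> tuples S) (X (Suc k)))"

end

theory Submission
  imports Defs
begin

text \<open>Perturbing an optimal \<open>P\<close> away from a feasible \<open>Q\<close> that satisfies the same inequality
  constraints with equality stays feasible, so \<open>Q\<close> is optimal as well. The optimal values of the
  linear programs strictly decrease along a non-terminating run. If \<open>P\<^sub>k\<close> and \<open>P\<^sub>l\<close> with \<open>l > k + 1\<close>
  had the same active constraints, \<open>P\<^sub>k\<close> would be optimal at \<open>X\<^sup>l\<close> too, so the minimum of
  \<open>g(\<cdot>; X\<^sup>k)\<close>, which is at least the optimal value at \<open>X\<^sup>k\<^sup>+\<^sup>1\<close>, would be at most the smaller one at
  \<open>X\<^sup>l\<close>. As there are finitely many sets of active constraints, the run terminates.\<close>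

text \<open>Only inequalities are recorded: the row-sum equalities hold at every feasible point. The
  index types are finite, so only finitely many values occur.\<close>

definition active_set :: "real ^ 'm ^ 'r \<Rightarrow> real ^ 'm ^ 'n \<Rightarrow> ('n \<times> 'm) set \<times> 'r set"
  where "active_set A P = ({(i, j). P $ i $ j = 0}, {r. (A *v (transpose P *v 1)) $ r = 0})"

lemma lp_feasible_iff:
  fixes P :: "real ^ 'm::finite ^ 'n::finite"
  shows "P \<in> lp_feasible A \<longleftrightarrow>
    P *v 1 = (1 / real CARD('n)) *\<^sub>R 1 \<and> (\<forall>i j. 0 \<le> P $ i $ j) \<and>
    (\<forall>r. 0 \<le> (A *v (transpose P *v 1)) $ r)"
  by (simp add: lp_feasible_def less_eq_vec_def)

lemma lp_feasible_entry_le_one: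
  fixes P :: "real ^ 'm::finite ^ 'n::finite"
  assumes "P \<in> lp_feasible A"
  shows "P $ i $ j \<le> 1"
proof -
  have nonneg: "0 \<le> P $ i $ j'" for j'
    using assms by (simp add: lp_feasible_iff)
  have "P $ i $ j \<le> (\<Sum>j'\<in>UNIV. P $ i $ j')"
    by (rule member_le_sum) (use nonneg in auto)
  also have "\<dots> = (P *v 1) $ i"
    by (simp add: matrix_vector_mult_def)
  also have "\<dots> = 1 / real CARD('n)"
    using assms by (simp add: lp_feasible_iff)
  also have "\<dots> \<le> 1"
    by (simp add: divide_le_eq_1 Suc_le_eq)
  finally show ?thesis .
qed

text \<open>Feasible entries lie between 0 and 1, which bounds each summand of the objective.
  Boundedness makes the \<open>INF\<close> in \<open>lp_value\<close> a genuine lower bound.\<close>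

lemma bdd_below_lp_objective:
  fixes C :: "real ^ 'm::finite ^ 'n::finite"
  shows "bdd_below ((\<lambda>P. C \<bullet> P) ` lp_feasible A)"
proof (rule bdd_belowI2)
  fix P :: "real ^ 'm ^ 'n" assume P: "P \<in> lp_feasible A"
  have "- \<bar>C $ i $ j\<bar> \<le> C $ i $ j * P $ i $ j" for i j
  proof -
    have "0 \<le> P $ i $ j"
      using P by (simp add: lp_feasible_iff)
    then have "\<bar>C $ i $ j * P $ i $ j\<bar> \<le> \<bar>C $ i $ j\<bar>"
      using lp_feasible_entry_le_one[OF P, of i j] by (simp add: abs_mult mult_left_le)
    then show ?thesis by linarith
  qed
  then show "(\<Sum>i\<in>UNIV. \<Sum>j\<in>UNIV. - \<bar>C $ i $ j\<bar>) \<le> C \<bullet> P"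
    unfolding inner_vec_def by (intro sum_mono) simp
qed

lemma lp_optimal_le:
  assumes "lp_optimal A C P" and "Q \<in> lp_feasible A"
  shows "C \<bullet> P \<le> C \<bullet> Q"
  using assms cINF_lower[OF bdd_below_lp_objective] by (simp add: lp_optimal_def lp_value_def)

text \<open>A slack constraint survives small \<open>t\<close> by continuity; a tight one stays at 0
  because the direction \<open>x - y\<close> vanishes.\<close>

lemma eventually_nonneg_perturbation:
  fixes x y :: real
  assumes "0 \<le> x" and "x = 0 \<Longrightarrow> y = 0"
  shows "\<forall>\<^sub>F t in at_right 0. 0 \<le> x + t * (x - y)"
proof (cases "x = 0")
  case False
  have "((\<lambda>t. x + t * (x - y)) \<longlongrightarrow> x + 0 * (x - y)) (at_right 0)"
    by (intro tendsto_intros)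
  then have "\<forall>\<^sub>F t in at_right 0. 0 < x + t * (x - y)"
    using assms False by (intro order_tendstoD) auto
  then show ?thesis
    by eventually_elim simp
qed (use assms in simp)

lemma lp_feasible_perturbation:
  assumes P: "P \<in> lp_feasible A" and Q: "Q \<in> lp_feasible A"
    and active: "active_set A P = active_set A Q"
  obtains t where "t > 0" and "P + t *\<^sub>R (P - Q) \<in> lp_feasible A"
proof -
  let ?R = "\<lambda>t. P + t *\<^sub>R (P - Q)"
  have entry: "\<forall>\<^sub>F t in at_right 0. 0 \<le> P $ i $ j + t * (P $ i $ j - Q $ i $ j)" for i j
    using P active by (intro eventually_nonneg_perturbation)
      (auto simp: lp_feasible_iff active_set_def set_eq_iff)
  have fair: "\<forall>\<^sub>F t in at_right 0. 0 \<le> (A *v (transpose P *v 1)) $ r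
      + t * ((A *v (transpose P *v 1)) $ r - (A *v (transpose Q *v 1)) $ r)" for r
    using P active by (intro eventually_nonneg_perturbation)
      (auto simp: lp_feasible_iff active_set_def set_eq_iff)
  \<comment> \<open>There are finitely many constraints, so one positive \<open>t\<close> serves all
    of them.\<close>
  have "\<forall>\<^sub>F t in at_right (0::real). 0 < t \<and>
      (\<forall>i j. 0 \<le> P $ i $ j + t * (P $ i $ j - Q $ i $ j)) \<and>
      (\<forall>r. 0 \<le> (A *v (transpose P *v 1)) $ r
        + t * ((A *v (transpose P *v 1)) $ r - (A *v (transpose Q *v 1)) $ r))"
    by (intro eventually_conj eventually_all_finite entry fair eventually_at_right_less)
  then obtain t where t: "0 < t" "\<And>i j. 0 \<le> P $ i $ j + t * (P $ i $ j - Q $ i $ j)"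
      "\<And>r. 0 \<le> (A *v (transpose P *v 1)) $ r
        + t * ((A *v (transpose P *v 1)) $ r - (A *v (transpose Q *v 1)) $ r)"
    using eventually_happens'[OF trivial_limit_at_right_real] by blast
  have "transpose (?R t) = transpose P + t *\<^sub>R (transpose P - transpose Q)"
    by (simp add: transpose_def vec_eq_iff)
  then have "A *v (transpose (?R t) *v 1) = A *v (transpose P *v 1)
      + t *\<^sub>R (A *v (transpose P *v 1) - A *v (transpose Q *v 1))"
    by (simp add: matrix_vector_mult_add_rdistrib matrix_vector_mult_diff_rdistrib
        matrix_vector_right_distrib matrix_vector_mult_diff_distrib
        scaleR_matrix_vector_assoc[symmetric] matrix_vector_mult_scaleR)
  \<comment> \<open>The row sums of \<open>P\<close> and \<open>Q\<close> agree, so the added term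
    is zero.\<close>
  moreover have "?R t *v 1 = P *v 1 + t *\<^sub>R (P *v 1 - Q *v 1)"
    by (simp add: matrix_vector_mult_add_rdistrib matrix_vector_mult_diff_rdistrib
        scaleR_matrix_vector_assoc[symmetric])
  ultimately have "?R t \<in> lp_feasible A"
    using P Q t by (simp add: lp_feasible_iff)
  with t(1) show ?thesis by (rule that)
qed

lemma lp_optimal_active_set_le:
  assumes opt: "lp_optimal A C P" and Q: "Q \<in> lp_feasible A"
    and active: "active_set A P = active_set A Q"
  shows "C \<bullet> Q \<le> C \<bullet> P"
proof -
  from opt have "P \<in> lp_feasible A"
    by (simp add: lp_optimal_def)
  from lp_feasible_perturbation[OF this Q active]
  obtain t where t: "t > 0" "P + t *\<^sub>R (P - Q) \<in> lp_feasible A" .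
  have "0 \<le> t * (C \<bullet> P - C \<bullet> Q)"
    using lp_optimal_le[OF opt t(2)] by (simp add: inner_add_right inner_diff_right)
  with t(1) show ?thesis
    by (simp add: zero_le_mult_iff)
qed

lemma mm_run_terminates:
  fixes C :: "'x ^ 'm::finite \<Rightarrow> real ^ 'm ^ 'n::finite" and A :: "real ^ 'm ^ 'r::finite"
  assumes run: "mm_run S A C X P"
  shows "\<exists>k. terminates_at C X P k"
proof (rule ccontr)
  assume nonterm: "\<not> ?thesis"
  \<comment> \<open>Without termination every iteration is executed, so the run conditions hold for
    all \<open>k\<close>.\<close>
  then have opt: "lp_optimal A (C (X k)) (P k)"
    and arg_min: "is_arg_min (surrogate C (P k)) (\<lambda>X'. X' \<in> tuples S) (X (Suc k))" for k
    using run by (auto simp: mm_run_def executes_def)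
  have X: "X k \<in> tuples S" for k
    using run arg_min by (cases k) (auto simp: mm_run_def is_arg_min_def)
  have feas: "P k \<in> lp_feasible A" for k
    using opt by (simp add: lp_optimal_def)
  have min: "C (X (Suc k)) \<bullet> P k \<le> C (X l) \<bullet> P k" for k l
    using arg_min[of k] X[of l] by (auto simp: is_arg_min_linorder surrogate_def)
  define f where "f k = C (X k) \<bullet> P k" for k
  \<comment> \<open>The feasible set does not depend on \<open>X\<close>, so \<open>P k\<close>
    remains a competitor at \<open>X (Suc k)\<close>.\<close>
  have step: "f (Suc k) \<le> C (X (Suc k)) \<bullet> P k" for k
    unfolding f_def by (rule lp_optimal_le[OF opt feas])
  have "f (Suc k) < f k" for k
  proof -
    have "C (X (Suc k)) \<bullet> P k \<noteq> f k"
      using nonterm by (simp add: f_def terminates_at_def surrogate_def)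
    then show ?thesis
      using step[of k] min[of k k] by (simp add: f_def)
  qed
  then have dec: "f l < f k" if "k < l" for k l
    using that by (rule lift_Suc_mono_less[of "\<lambda>k. - f k", simplified])
  \<comment> \<open>Consecutive iterations may share their active constraints, hence the even indices.\<close>
  have "\<not> inj (\<lambda>i. active_set A (P (2 * i)))"
    using finite_imageD[of "\<lambda>i. active_set A (P (2 * i))" "UNIV :: nat set"] by auto
  then obtain i j where "i < j" and active: "active_set A (P (2 * j)) = active_set A (P (2 * i))"
    unfolding inj_def by (metis linorder_neq_iff)
  have "C (X (2 * j)) \<bullet> P (2 * i) \<le> f (2 * j)"
    unfolding f_def by (rule lp_optimal_active_set_le[OF opt feas active])
  \<comment> \<open>Here the even indices matter: \<open>i < j\<close> gives
    \<open>2 * i + 1 < 2 * j\<close>, so the decrease is strict.\<close>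
  also have "\<dots> < f (Suc (2 * i))"
    using \<open>i < j\<close> by (intro dec) simp
  also have "\<dots> \<le> C (X (Suc (2 * i))) \<bullet> P (2 * i)"
    by (rule step)
  also have "\<dots> \<le> C (X (2 * j)) \<bullet> P (2 * i)"
    by (rule min)
  finally show False by simp
qed

theorem theorem5p4:
  fixes D :: "'d::euclidean_space set" and S :: "'x::euclidean_space set"
    and Y :: "'y::euclidean_space set"
    and Z :: "'n::finite \<Rightarrow> 'd \<times> 'x \<times> 'y"
    and Dh :: "'m::finite \<Rightarrow> 'd" and Yh :: "'m \<Rightarrow> 'y"
    and c :: "'d \<times> 'x \<times> 'y \<Rightarrow> 'd \<times> 'x \<times> 'y \<Rightarrow> real"
    and \<epsilon> :: real and p :: "'y pmf"
    and A :: "real ^ 'm ^ 'r::finite"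
    and C :: "'x ^ 'm \<Rightarrow> real ^ 'm ^ 'n"
    and X :: "nat \<Rightarrow> 'x ^ 'm" and P :: "nat \<Rightarrow> real ^ 'm ^ 'n"
  assumes "finite D" and "finite Y"
    and "\<And>i. Z i \<in> D \<times> S \<times> Y"
    and "\<And>j. Dh j \<in> D" and "\<And>j. Yh j \<in> Y"
    and C_def: "C = cost_matrix c Z Dh Yh"
    \<comment> \<open>\<open>S\<close> itself need not be convex; if it is, this is convexity on all of \<open>tuples S\<close>.\<close>
    and convex_cost: "\<And>i j K. K \<subseteq> tuples S \<Longrightarrow> convex K \<Longrightarrow> convex_on K (\<lambda>X'. C X' $ i $ j)"
    and "set_pmf p \<subseteq> Y"
    and "fairness_matrix \<epsilon> p D Y Dh Yh A"
    and run: "mm_run S A C X P"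
    and unique: "\<And>k. executes C X P k \<Longrightarrow>
      \<exists>!X'. is_arg_min (surrogate C (P k)) (\<lambda>X'. X' \<in> tuples S) X'"
  shows "\<exists>k. terminates_at C X P k"
  using run by (rule mm_run_terminates)

end
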